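(* Let $\mathbf{F}^*$ and $R$ be the output of NNS-EMD (Greedy Protocol) on $(S,C,\mathbf{D})$. Let $\mathbf{F}$ be any feasible flow, and let $\mathbf{F}^{opt}$ be an optimal flow, i.e. a feasible flow minimizing $\sum_{i,j}F_{i,j}D_{i,j}$ over all feasible flows. For a supplier $i\in\{1,\dots,m\}$ that has at least one matched consumer in exactly the iterations $t_1<t_2<\dots<t_\Delta$ (with $\Delta>0$ an integer, $i\in \mathbf{m}^{(t_1)}\cap\dots\cap\mathbf{m}^{(t_\Delta)}$, and $|\mathbf{a}_i^{(u)}|\ge 1$ for $u\in\{t_1,\dots,t_\Delta\}$) and whose weight is not exhausted until iteration $t_\Delta$, in which it is exhausted, let $J_i=\{j : F^*_{i,j}>0\}$ be the set of indices of all consumers that receive flow from supplier $i$ under $\mathbf{F}^*$, and let $j_i^*\in J_i$ be the index of a furthest such consumer, i.e. $D_{i,j_i^*}=\max_{j\in J_i}D_{i,j}$. Then $$\sum_{j}F^*_{i,j}D_{i,j}-\sum_j F_{i,j}D_{i,j}\;\le\; D_{i,j_i^*}\Big(\sum_{j\in J_i}(c_j-F_{i,j})\Big),$$ and the difference between $R=\sum_{i,j}F^*_{i,j}D_{i,j}$ and the optimal value $\mathrm{EMD}(S,C)=\sum_{i,j}F^{opt}_{i,j}D_{i,j}$ satisfies $$0\;\le\;\sum_{i,j}F^*_{i,j}D_{i,j}-\sum_{i,j}F^{opt}_{i,j}D_{i,j}\;\le\;\sum_i D_{i,j_i^*}\Big(\sum_{j\in J_i}(c_j-F^{opt}_{i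,j})\Big).$$
   Context: Setting. $S$ and $C$ are discrete probability distributions (histograms) on a finite metric space $(X,d_X)$. $S$ has $m$ bins ("suppliers") with weights $s_i>0$, $C$ has $n$ bins ("consumers") with weights $c_j>0$, and $\sum_{i=1}^m s_i=\sum_{j=1}^n c_j=1$. $\mathbf{D}=(D_{i,j})$ is the $m\times n$ matrix of non-negative ground distances, $D_{i,j}$ being the distance between the location of supplier $i$ and that of consumer $j$. A feasible flow is an $m\times n$ matrix $\mathbf{F}$ with $F_{i,j}\ge 0$, $\sum_i F_{i,j}=c_j$ for all $j$, and $\sum_j F_{i,j}=s_i$ for all $i$. $\mathrm{EMD}(S,C)$ is the minimum of $\sum_{i,j}F_{i,j}D_{i,j}$ over feasible flows. Throughout, $s_i,c_j$ denote the initial weights. Algorithm NNS-EMD with Greedy Protocol. It maintains current weights $\sigma_i$ (initially $s_i$) and $\gamma_j$ (initially $c_j$), a cost $R$ (initially $0$) and a matrix $\mathbf{F}^*$ (initially $0$). For $t=1,2,\dots$, while some current weight is positive, do the following iteration: 1. Let $\mathbf{m}^{(t)}=\{i:\sigma_i>0\}$ and $\mathbf{n}^{(t)}=\{j:\gamma_j>0\}$ be the active suppliers and consumers. 2. For each $j\in\mathbf{n}^{(t)}$ let $\mathrm{NNS}(j)\in\arg\min_{i\in\mathbf{m}^{(t)}}D_{i,j}$ (one nearest active supplier). 3. For each $i\in\mathbf{m}^{(t)}$, let $\mathbf{a}_i^{(t)}=\{j\in\mathbf{n}^{(t)}:\mathrm{NNS}(j)=i\}$ (its matched consumers) and let $\widetilde{\mathbf{a}}_i^{(t)}$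 be the list of the elements of $\mathbf{a}_i^{(t)}$ sorted in nondecreasing order of $D_{i,j}$, with $l$-th entry $\widetilde{\mathbf{a}}_i^{(t)}[l]$. For $l=1,2,\dots,|\mathbf{a}_i^{(t)}|$, as long as $\sigma_i>0$: put $j=\widetilde{\mathbf{a}}_i^{(t)}[l]$, $f=\min(\sigma_i,\gamma_j)$, and update $\sigma_i\leftarrow\sigma_i-f$, $\gamma_j\leftarrow\gamma_j-f$, $R\leftarrow R+fD_{i,j}$, $F^*_{i,j}\leftarrow F^*_{i,j}+f$. The output is $R$ and $\mathbf{F}^*$. *)

theory Defs
  imports "HOL-Analysis.Analysis"
begin

text \<open>
  Suppliers are indexed by \<open>{1..m}\<close> and consumers by \<open>{1..n}\<close>; weight vectors and matrices are
  functions on \<open>nat\<close> of which only the values at these indices matter.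
  Bin locations are not required to be pairwise distinct.
\<close>

definition histogram :: "'a set \<Rightarrow> nat \<Rightarrow> (nat \<Rightarrow> 'a) \<Rightarrow> (nat \<Rightarrow> real) \<Rightarrow> bool" where
  "histogram X k loc w \<longleftrightarrow>
     (\<forall>i\<in>{1..k}. loc i \<in> X) \<and> (\<forall>i\<in>{1..k}. 0 < w i) \<and> (\<Sum>i=1..k. w i) = 1"

definition feasible_flow ::
  "nat \<Rightarrow> nat \<Rightarrow> (nat \<Rightarrow> real) \<Rightarrow> (nat \<Rightarrow> real) \<Rightarrow> (nat \<Rightarrow> nat \<Rightarrow> real) \<Rightarrow> bool" where
  "feasible_flow m n s c F \<longleftrightarrow>
     (\<forall>i\<in>{1..m}. \<forall>j\<in>{1..n}. 0 \<le> F i j) \<and>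
     (\<forall>j\<in>{1..n}. (\<Sum>i=1..m. F i j) = c j) \<and>
     (\<forall>i\<in>{1..m}. (\<Sum>j=1..n. F i j) = s i)"

definition flow_cost ::
  "nat \<Rightarrow> nat \<Rightarrow> (nat \<Rightarrow> nat \<Rightarrow> real) \<Rightarrow> (nat \<Rightarrow> nat \<Rightarrow> real) \<Rightarrow> real" where
  "flow_cost m n D F = (\<Sum>i=1..m. \<Sum>j=1..n. F i j * D i j)"

definition optimal_flow ::
  "nat \<Rightarrow> nat \<Rightarrow> (nat \<Rightarrow> real) \<Rightarrow> (nat \<Rightarrow> real) \<Rightarrow> (nat \<Rightarrow> nat \<Rightarrow> real) \<Rightarrow>
    (nat \<Rightarrow> nat \<Rightarrow> real) \<Rightarrow> bool" where
  "optimal_flow m n s c D F \<longleftrightarrow>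
     feasible_flow m n s c F \<and>
     (\<forall>G. feasible_flow m n s c G \<longrightarrow> flow_cost m n D F \<le> flow_cost m n D G)"

definition EMD ::
  "nat \<Rightarrow> nat \<Rightarrow> (nat \<Rightarrow> real) \<Rightarrow> (nat \<Rightarrow> real) \<Rightarrow> (nat \<Rightarrow> nat \<Rightarrow> real) \<Rightarrow> real" where
  "EMD m n s c D = (LEAST v. \<exists>F. feasible_flow m n s c F \<and> v = flow_cost m n D F)"

record state =
  sup_weight :: "nat \<Rightarrow> real"
  con_weight :: "nat \<Rightarrow> real"
  total_cost :: real
  flow :: "nat \<Rightarrow> nat \<Rightarrow> real"

definition initial_state :: "(nat \<Rightarrow> real) \<Rightarrow> (nat \<Rightarrow> real) \<Rightarrow> state" where
  "initial_state s c =
     \<lparr>sup_weight = s, con_weight = c, total_cost = 0, flow = (\<lambda>i j. 0)\<rparr>"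

definition active_suppliers :: "nat \<Rightarrow> state \<Rightarrow> nat set" where
  "active_suppliers m st = {i \<in> {1..m}. 0 < sup_weight st i}"

definition active_consumers :: "nat \<Rightarrow> state \<Rightarrow> nat set" where
  "active_consumers n st = {j \<in> {1..n}. 0 < con_weight st j}"

definition running :: "nat \<Rightarrow> nat \<Rightarrow> state \<Rightarrow> bool" where
  "running m n st \<longleftrightarrow>
     (\<exists>i\<in>{1..m}. 0 < sup_weight st i) \<or> (\<exists>j\<in>{1..n}. 0 < con_weight st j)"

definition transfer_step :: "(nat \<Rightarrow> nat \<Rightarrow> real) \<Rightarrow> nat \<Rightarrow> nat \<Rightarrow> state \<Rightarrow> state" where
  "transfer_step D i j st =
     (let f = min (sup_weight st i) (con_weight st j) in
      \<lparr>sup_weight = (sup_weight st)(i := sup_weight st i - f),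
       con_weight = (con_weight st)(j := con_weight st j - f),
       total_cost = total_cost st + f * D i j,
       flow = (flow st)(i := (flow st i)(j := flow st i j + f))\<rparr>)"

fun serve :: "(nat \<Rightarrow> nat \<Rightarrow> real) \<Rightarrow> nat \<Rightarrow> nat list \<Rightarrow> state \<Rightarrow> state" where
  "serve D i [] st = st"
| "serve D i (j # js) st =
     (if 0 < sup_weight st i then serve D i js (transfer_step D i j st) else st)"

text \<open>
  The algorithm leaves some choices open: which nearest supplier is taken when there are ties,
  how ties are broken when the matched consumers are sorted, and in which order the active
  suppliers are processed.  A value of type \<open>choices\<close> resolves them for every iteration \<open>t \<ge> 1\<close>
  (the first argument of each field); \<open>valid_choices\<close> below states what a resolution has to satisfy.
\<close>

record choices =
  nns :: "nat \<Rightarrow> nat \<Rightarrow> nat"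
  supplier_order :: "nat \<Rightarrow> nat list"
  consumer_order :: "nat \<Rightarrow> nat \<Rightarrow> nat list"

definition iteration ::
  "(nat \<Rightarrow> nat \<Rightarrow> real) \<Rightarrow> choices \<Rightarrow> nat \<Rightarrow> state \<Rightarrow> state" where
  "iteration D ch t st =
     fold (\<lambda>i. serve D i (consumer_order ch t i)) (supplier_order ch t) st"

text \<open>
  \<open>state_after \<dots> t\<close> is the state after iteration \<open>t\<close>; it stays constant once the loop has stopped.
  Hence iteration \<open>t\<close> starts in \<open>state_after \<dots> (t - 1)\<close>.
\<close>

primrec state_after ::
  "nat \<Rightarrow> nat \<Rightarrow> (nat \<Rightarrow> real) \<Rightarrow> (nat \<Rightarrow> real) \<Rightarrow> (nat \<Rightarrow> nat \<Rightarrow> real) \<Rightarrow> choices \<Rightarrow>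
    nat \<Rightarrow> state" where
  "state_after m n s c D ch 0 = initial_state s c"
| "state_after m n s c D ch (Suc t) =
     (let st = state_after m n s c D ch t in
      if running m n st then iteration D ch (Suc t) st else st)"

definition active_suppliers_at ::
  "nat \<Rightarrow> nat \<Rightarrow> (nat \<Rightarrow> real) \<Rightarrow> (nat \<Rightarrow> real) \<Rightarrow> (nat \<Rightarrow> nat \<Rightarrow> real) \<Rightarrow> choices \<Rightarrow>
    nat \<Rightarrow> nat set" where
  "active_suppliers_at m n s c D ch t =
     active_suppliers m (state_after m n s c D ch (t - 1))"

definition active_consumers_at ::
  "nat \<Rightarrow> nat \<Rightarrow> (nat \<Rightarrow> real) \<Rightarrow> (nat \<Rightarrow> real) \<Rightarrow> (nat \<Rightarrow> nat \<Rightarrow> real) \<Rightarrow> choices \<Rightarrow>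
    nat \<Rightarrow> nat set" where
  "active_consumers_at m n s c D ch t =
     active_consumers n (state_after m n s c D ch (t - 1))"

definition matched_consumers_at ::
  "nat \<Rightarrow> nat \<Rightarrow> (nat \<Rightarrow> real) \<Rightarrow> (nat \<Rightarrow> real) \<Rightarrow> (nat \<Rightarrow> nat \<Rightarrow> real) \<Rightarrow> choices \<Rightarrow>
    nat \<Rightarrow> nat \<Rightarrow> nat set" where
  "matched_consumers_at m n s c D ch t i =
     {j \<in> active_consumers_at m n s c D ch t. nns ch t j = i}"

definition valid_choices ::
  "nat \<Rightarrow> nat \<Rightarrow> (nat \<Rightarrow> real) \<Rightarrow> (nat \<Rightarrow> real) \<Rightarrow> (nat \<Rightarrow> nat \<Rightarrow> real) \<Rightarrow> choices \<Rightarrow> bool" where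
  "valid_choices m n s c D ch \<longleftrightarrow>
     (\<forall>t\<ge>1. running m n (state_after m n s c D ch (t - 1)) \<longrightarrow>
        (\<forall>j\<in>active_consumers_at m n s c D ch t.
           is_arg_min (\<lambda>i. D i j) (\<lambda>i. i \<in> active_suppliers_at m n s c D ch t) (nns ch t j)) \<and>
        distinct (supplier_order ch t) \<and>
        set (supplier_order ch t) = active_suppliers_at m n s c D ch t \<and>
        (\<forall>i\<in>active_suppliers_at m n s c D ch t.
           distinct (consumer_order ch t i) \<and>
           set (consumer_order ch t i) = matched_consumers_at m n s c D ch t i \<and>
           sorted (map (D i) (consumer_order ch t i))))"

text \<open>
  The number of iterations performed.  Since \<open>LEAST\<close> says nothing when the loop never stops, a
  statement about \<open>nns_emd_output\<close> includes termination rather than assuming it.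
\<close>

definition num_iterations ::
  "nat \<Rightarrow> nat \<Rightarrow> (nat \<Rightarrow> real) \<Rightarrow> (nat \<Rightarrow> real) \<Rightarrow> (nat \<Rightarrow> nat \<Rightarrow> real) \<Rightarrow> choices \<Rightarrow> nat" where
  "num_iterations m n s c D ch = (LEAST t. \<not> running m n (state_after m n s c D ch t))"

definition nns_emd_output ::
  "nat \<Rightarrow> nat \<Rightarrow> (nat \<Rightarrow> real) \<Rightarrow> (nat \<Rightarrow> real) \<Rightarrow> (nat \<Rightarrow> nat \<Rightarrow> real) \<Rightarrow> choices \<Rightarrow>
    real \<times> (nat \<Rightarrow> nat \<Rightarrow> real)" where
  "nns_emd_output m n s c D ch =
     (let st = state_after m n s c D ch (num_iterations m n s c D ch)
      in (total_cost st, flow st))"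

definition exhausted_in_last_match ::
  "nat \<Rightarrow> nat \<Rightarrow> (nat \<Rightarrow> real) \<Rightarrow> (nat \<Rightarrow> real) \<Rightarrow> (nat \<Rightarrow> nat \<Rightarrow> real) \<Rightarrow> choices \<Rightarrow>
    nat \<Rightarrow> nat \<Rightarrow> (nat \<Rightarrow> nat) \<Rightarrow> bool" where
  "exhausted_in_last_match m n s c D ch i \<Delta> \<tau> \<longleftrightarrow>
     0 < \<Delta> \<and> strict_mono_on {1..\<Delta>} \<tau> \<and>
     \<tau> ` {1..\<Delta>} =
       {t \<in> {1..num_iterations m n s c D ch}.
          i \<in> active_suppliers_at m n s c D ch t \<and>
          1 \<le> card (matched_consumers_at m n s c D ch t i)} \<and>
     (\<forall>t < \<tau> \<Delta>. 0 < sup_weight (state_after m n s c D ch t) i) \<and>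
     sup_weight (state_after m n s c D ch (\<tau> \<Delta>)) i = 0"

definition receivers :: "nat \<Rightarrow> (nat \<Rightarrow> nat \<Rightarrow> real) \<Rightarrow> nat \<Rightarrow> nat set" where
  "receivers n F i = {j \<in> {1..n}. 0 < F i j}"

definition is_furthest_receiver ::
  "nat \<Rightarrow> (nat \<Rightarrow> nat \<Rightarrow> real) \<Rightarrow> (nat \<Rightarrow> nat \<Rightarrow> real) \<Rightarrow> nat \<Rightarrow> nat \<Rightarrow> bool" where
  "is_furthest_receiver n D F i j \<longleftrightarrow>
     j \<in> receivers n F i \<and> D i j = Max (D i ` receivers n F i)"

end

theory Submission
  imports Defs
begin

text \<open>
  The output is a feasible flow, so \<open>Fstar i j \<le> c j\<close>. Since receivers of a supplier \<open>i\<close> are no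
  further away than \<open>jstar i\<close> and distances are non-negative, replacing \<open>Fstar i j\<close> by \<open>c j\<close> and then
  \<open>D i j\<close> by \<open>D i (jstar i)\<close> only increases the difference of the costs. Feasibility rests on
  termination: total supply equals total demand, so a running state has an active consumer, and in
  each iteration an active consumer or its nearest supplier is exhausted.
\<close>

section \<open>Loop invariant and monotone weights, for single transfers and for one
  supplier\<close>

text \<open>The balance equations say that shipped plus remaining weight is the initial weight of
  each bin. Once nothing remains they turn into the marginal conditions of a feasible flow, and the
  last conjunct identifies the accumulated cost with the cost of that flow.\<close>

definition valid_state ::
  "nat \<Rightarrow> nat \<Rightarrow> (nat \<Rightarrow> real) \<Rightarrow> (nat \<Rightarrow> real) \<Rightarrow> (nat \<Rightarrow> nat \<Rightarrow> real) \<Rightarrow> state \<Rightarrow> bool" where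
  "valid_state m n s c D st \<longleftrightarrow>
     (\<forall>i\<in>{1..m}. 0 \<le> sup_weight st i) \<and>
     (\<forall>j\<in>{1..n}. 0 \<le> con_weight st j) \<and>
     (\<forall>i\<in>{1..m}. \<forall>j\<in>{1..n}. 0 \<le> flow st i j) \<and>
     (\<forall>i\<in>{1..m}. (\<Sum>j=1..n. flow st i j) + sup_weight st i = s i) \<and>
     (\<forall>j\<in>{1..n}. (\<Sum>i=1..m. flow st i j) + con_weight st j = c j) \<and>
     total_cost st = flow_cost m n D (flow st)"

text \<open>The later state comes first. This relation carries exhaustion of a bin forward in time
  and makes the active sets shrink.\<close>

definition weights_le :: "nat \<Rightarrow> nat \<Rightarrow> state \<Rightarrow> state \<Rightarrow> bool" where
  "weights_le m n st' st \<longleftrightarrow>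
     (\<forall>i\<in>{1..m}. sup_weight st' i \<le> sup_weight st i) \<and>
     (\<forall>j\<in>{1..n}. con_weight st' j \<le> con_weight st j)"

lemma weights_le_refl: "weights_le m n st st"
  by (simp add: weights_le_def)

lemma weights_le_trans:
  "weights_le m n st'' st' \<Longrightarrow> weights_le m n st' st \<Longrightarrow> weights_le m n st'' st"
  unfolding weights_le_def by (meson order_trans)

text \<open>Function updates are rewritten as additive corrections, so that sums over rows and
  columns split into the old sum and a sum with a single nonzero term.\<close>

lemma transfer_step_simps:
  "sup_weight (transfer_step D i j st) i' =
     sup_weight st i' - (if i' = i then min (sup_weight st i) (con_weight st j) else 0)"
  "con_weight (transfer_step D i j st) j' =
     con_weight st j' - (if j' = j then min (sup_weight st i) (con_weight st j) else 0)"
  "total_cost (transfer_step D i j st) =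
     total_cost st + min (sup_weight st i) (con_weight st j) * D i j"
  "flow (transfer_step D i j st) i' j' =
     flow st i' j' +
     (if i' = i then if j' = j then min (sup_weight st i) (con_weight st j) else 0 else 0)"
  by (simp_all add: transfer_step_def Let_def)

text \<open>The amount moved is bounded by both weights, so neither becomes negative; row
  \<open>i\<close> and column \<open>j\<close> of the flow gain exactly what the two weights
  lose.\<close>

lemma valid_state_transfer_step:
  assumes "valid_state m n s c D st" "i \<in> {1..m}" "j \<in> {1..n}"
  shows "valid_state m n s c D (transfer_step D i j st)"
    and "weights_le m n (transfer_step D i j st) st"
proof -
  define f where "f = min (sup_weight st i) (con_weight st j)"
  have f: "0 \<le> f" "f \<le> sup_weight st i" "f \<le> con_weight st j"
    using assms by (auto simp: f_def valid_state_def)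
  note step = transfer_step_simps[of D i j st, folded f_def]
  have row: "(\<Sum>j'=1..n. flow (transfer_step D i j st) i' j') =
      (\<Sum>j'=1..n. flow st i' j') + (if i' = i then f else 0)" for i'
    using assms(3) by (simp add: step sum.distrib)
  have col: "(\<Sum>i'=1..m. flow (transfer_step D i j st) i' j') =
      (\<Sum>i'=1..m. flow st i' j') + (if j' = j then f else 0)" for j'
    using assms(2) by (simp add: step sum.distrib)
  have "(\<Sum>j'=1..n. flow (transfer_step D i j st) i' j' * D i' j') =
      (\<Sum>j'=1..n. flow st i' j' * D i' j') + (if i' = i then f * D i j else 0)" for i'
    using assms(3)
    by (simp add: step sum.distrib distrib_right if_distrib[of "\<lambda>x. x * _"] cong: if_cong)
  then have "flow_cost m n D (flow (transfer_step D i j st)) =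
      flow_cost m n D (flow st) + f * D i j"
    using assms(2) by (simp add: flow_cost_def sum.distrib)
  then show "valid_state m n s c D (transfer_step D i j st)"
    using assms(1) f unfolding valid_state_def row col by (auto simp: step)
  show "weights_le m n (transfer_step D i j st) st"
    using f by (simp add: weights_le_def step)
qed

lemma valid_state_serve:
  assumes "valid_state m n s c D st" "i \<in> {1..m}" "set js \<subseteq> {1..n}"
  shows "valid_state m n s c D (serve D i js st) \<and> weights_le m n (serve D i js st) st"
  using assms
proof (induction js arbitrary: st)
  case Nil
  then show ?case by (simp add: weights_le_refl)
next
  case (Cons j js)
  have "valid_state m n s c D (transfer_step D i j st)"
    "weights_le m n (transfer_step D i j st) st"
    using valid_state_transfer_step[of m n s c D st i j] Cons.prems by auto
  then show ?case
    using Cons.IH[of "transfer_step D i j st"] Cons.prems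
    by (auto simp: weights_le_refl intro: weights_le_trans)
qed

text \<open>Either the list is cut short because the supplier ran out, or the transfer to
  \<open>j\<close> takes place and its minimum empties one side. The form \<open>\<le> 0\<close>
  passes to later states by \<open>weights_le\<close> alone.\<close>

lemma serve_exhausts:
  assumes "valid_state m n s c D st" "i \<in> {1..m}" "set js \<subseteq> {1..n}" "j \<in> set js"
  shows "sup_weight (serve D i js st) i \<le> 0 \<or> con_weight (serve D i js st) j \<le> 0"
  using assms
proof (induction js arbitrary: st)
  case Nil
  then show ?case by simp
next
  case (Cons k js)
  let ?st = "transfer_step D i k st"
  have st: "valid_state m n s c D ?st"
    using valid_state_transfer_step[of m n s c D st i k] Cons.prems by auto
  show ?case
  proof (cases "0 < sup_weight st i")
    case True
    show ?thesis
    proof (cases "j \<in> set js")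
      case True
      then show ?thesis using Cons.IH[OF st] Cons.prems by auto
    next
      case False
      then have "j = k" using Cons.prems by auto
      then have "sup_weight ?st i \<le> 0 \<or> con_weight ?st j \<le> 0"
        by (simp add: transfer_step_simps min_def)
      moreover have "weights_le m n (serve D i js ?st) ?st"
        using valid_state_serve[OF st] Cons.prems by auto
      moreover have "j \<in> {1..n}" using Cons.prems by auto
      ultimately show ?thesis
        using Cons.prems(2) True unfolding weights_le_def by fastforce
    qed
  qed simp
qed

lemma sup_weight_serve_other: "i' \<noteq> i \<Longrightarrow> sup_weight (serve D i js st) i' = sup_weight st i'"
  by (induction js arbitrary: st) (auto simp: transfer_step_simps)

section \<open>Processing all active suppliers within one iteration\<close>

lemma valid_state_fold_serve:
  assumes "valid_state m n s c D st" "set is \<subseteq> {1..m}" "\<And>i. i \<in> set is \<Longrightarrow> set (js i) \<subseteq> {1..n}"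
  shows "valid_state m n s c D (fold (\<lambda>i. serve D i (js i)) is st) \<and>
    weights_le m n (fold (\<lambda>i. serve D i (js i)) is st) st"
  using assms
proof (induction "is" arbitrary: st)
  case Nil
  then show ?case by (simp add: weights_le_refl)
next
  case (Cons i "is")
  have "valid_state m n s c D (serve D i (js i) st) \<and> weights_le m n (serve D i (js i) st) st"
    using valid_state_serve[of m n s c D st i "js i"] Cons.prems by auto
  then show ?case
    using Cons.IH[of "serve D i (js i) st"] Cons.prems by (auto intro: weights_le_trans)
qed

text \<open>The order is split at supplier \<open>i\<close>: the invariant survives the prefix,
  serving \<open>i\<close> empties it or \<open>j\<close>, and the suffix cannot raise a weight
  again.\<close>

lemma fold_serve_exhausts:
  assumes "valid_state m n s c D st" "set is \<subseteq> {1..m}" "\<And>i. i \<in> set is \<Longrightarrow> set (js i) \<subseteq> {1..n}"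
    and "i \<in> set is" "j \<in> set (js i)"
  shows "sup_weight (fold (\<lambda>i. serve D i (js i)) is st) i \<le> 0 \<or>
    con_weight (fold (\<lambda>i. serve D i (js i)) is st) j \<le> 0"
proof -
  obtain xs ys where split: "is = xs @ i # ys"
    using assms(4) by (meson split_list)
  define st1 where "st1 = fold (\<lambda>i. serve D i (js i)) xs st"
  define st2 where "st2 = serve D i (js i) st1"
  have st1: "valid_state m n s c D st1"
    using valid_state_fold_serve[of m n s c D st xs js] assms split by (auto simp: st1_def)
  have ij: "i \<in> {1..m}" "set (js i) \<subseteq> {1..n}" "j \<in> {1..n}"
    using assms by blast+
  have "valid_state m n s c D st2"
    using valid_state_serve[OF st1] ij by (simp add: st2_def)
  then have "weights_le m n (fold (\<lambda>i. serve D i (js i)) ys st2) st2"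
    using valid_state_fold_serve[of m n s c D st2 ys js] assms split by auto
  moreover have "sup_weight st2 i \<le> 0 \<or> con_weight st2 j \<le> 0"
    unfolding st2_def by (rule serve_exhausts[OF st1]) (use ij assms(5) in auto)
  ultimately show ?thesis
    using ij unfolding weights_le_def
    by (auto simp: split st1_def[symmetric] st2_def[symmetric] intro: order_trans)
qed

text \<open>The weight of a supplier changes only when it is served itself with a nonempty list.
  This forces the iteration that exhausts a supplier to be one in which it has a matched
  consumer.\<close>

lemma sup_weight_fold_serve_unmatched:
  "js i = [] \<Longrightarrow> sup_weight (fold (\<lambda>i. serve D i (js i)) is st) i = sup_weight st i"
proof (induction "is" arbitrary: st)
  case (Cons k "is")
  then show ?case by (cases "k = i") (auto simp: sup_weight_serve_other)
qed simp

section \<open>Consequences of the invariant, and enumeration of finite sets\<close>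

lemma not_running_valid_state:
  assumes "valid_state m n s c D st" "\<not> running m n st"
  shows "feasible_flow m n s c (flow st)"
proof -
  have "sup_weight st i = 0" if "i \<in> {1..m}" for i
    using assms that unfolding valid_state_def running_def by (meson not_less order_antisym)
  moreover have "con_weight st j = 0" if "j \<in> {1..n}" for j
    using assms that unfolding valid_state_def running_def by (meson not_less order_antisym)
  ultimately show ?thesis
    using assms(1) by (auto simp: valid_state_def feasible_flow_def)
qed

text \<open>Summing the flow by rows and by columns gives the same total, so remaining supply equals
  remaining demand. Leftover supply alone, which also satisfies \<open>running\<close>, is thereby
  excluded.\<close>

lemma running_active_consumer:
  assumes "valid_state m n s c D st" "running m n st" "(\<Sum>i=1..m. s i) = (\<Sum>j=1..n. c j)"
  obtains j where "j \<in> active_consumers n st"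
proof -
  have "(\<Sum>i=1..m. s i) = (\<Sum>i=1..m. (\<Sum>j=1..n. flow st i j) + sup_weight st i)"
    using assms(1) by (intro sum.cong) (auto simp: valid_state_def)
  moreover have "(\<Sum>j=1..n. c j) = (\<Sum>j=1..n. (\<Sum>i=1..m. flow st i j) + con_weight st j)"
    using assms(1) by (intro sum.cong) (auto simp: valid_state_def)
  ultimately have eq: "(\<Sum>i=1..m. sup_weight st i) = (\<Sum>j=1..n. con_weight st j)"
    using assms(3) sum.swap[of "flow st" "{1..n}" "{1..m}"] by (simp add: sum.distrib)
  have "\<exists>j\<in>{1..n}. 0 < con_weight st j"
  proof (rule ccontr)
    assume *: "\<not> ?thesis"
    then obtain i where i: "i \<in> {1..m}" "0 < sup_weight st i"
      using assms(2) by (auto simp: running_def)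
    have "0 < (\<Sum>i=1..m. sup_weight st i)"
      using assms(1) i by (intro sum_pos2[where i = i]) (auto simp: valid_state_def)
    moreover have "(\<Sum>j=1..n. con_weight st j) \<le> 0"
      using * by (intro sum_nonpos) (auto simp: not_less)
    ultimately show False using eq by simp
  qed
  then show ?thesis using that by (auto simp: active_consumers_def)
qed

lemma weights_le_active:
  assumes "weights_le m n st' st"
  shows "active_suppliers m st' \<subseteq> active_suppliers m st"
    and "active_consumers n st' \<subseteq> active_consumers n st"
  using assms unfolding weights_le_def active_suppliers_def active_consumers_def
  by (blast intro: less_le_trans)+

lemma finite_active: "finite (active_suppliers m st)" "finite (active_consumers n st)"
  by (simp_all add: active_suppliers_def active_consumers_def)

lemma valid_state_initial:
  assumes "\<And>i. i \<in> {1..m} \<Longrightarrow> 0 \<le> s i" "\<And>j. j \<in> {1..n} \<Longrightarrow> 0 \<le> c j"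
  shows "valid_state m n s c D (initial_state s c)"
  using assms by (auto simp: valid_state_def initial_state_def flow_cost_def)

text \<open>Supplies the increasing enumeration of iterations that
  \<open>exhausted_in_last_match\<close> asks for.\<close>

lemma ex_strict_mono_image_card:
  fixes A :: "'a::linorder set"
  assumes "finite A"
  obtains \<tau> where "strict_mono_on {1..card A} \<tau>" "\<tau> ` {1..card A} = A"
proof
  \<comment> \<open>List positions start at 0, the enumeration at 1.\<close>
  let ?\<tau> = "\<lambda>k. sorted_list_of_set A ! (k - 1)"
  have len: "length (sorted_list_of_set A) = card A" by simp
  show "strict_mono_on {1..card A} ?\<tau>"
    using strict_sorted_list_of_set[of A]
    by (auto simp: strict_mono_on_def sorted_wrt_iff_nth_less)
  have "?\<tau> ` {1..card A} = (!) (sorted_list_of_set A) ` {..<card A}"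
    unfolding image_image[of _ "\<lambda>k. k - 1", symmetric]
    by (rule arg_cong[where f = "image _"]) (auto simp: image_iff intro!: bexI[of _ "Suc _"])
  also have "\<dots> = set (sorted_list_of_set A)"
    unfolding set_conv_nth len by auto
  finally show "?\<tau> ` {1..card A} = A" using assms by simp
qed

section \<open>A fixed run of the algorithm: termination and exhaustion of every supplier\<close>

context
  fixes m n :: nat and s c :: "nat \<Rightarrow> real" and D :: "nat \<Rightarrow> nat \<Rightarrow> real" and ch :: choices
  assumes s_pos: "\<And>i. i \<in> {1..m} \<Longrightarrow> 0 < s i"
    and c_pos: "\<And>j. j \<in> {1..n} \<Longrightarrow> 0 < c j"
    and balanced: "(\<Sum>i=1..m. s i) = (\<Sum>j=1..n. c j)"
    and valid: "valid_choices m n s c D ch"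
begin

abbreviation "after \<equiv> state_after m n s c D ch"

text \<open>Shifts the index: iteration \<open>Suc t\<close> starts in \<open>after t\<close>, so
  the subtraction in \<open>t - 1\<close> disappears.\<close>

lemma valid_choices_order:
  assumes "running m n (after t)"
  shows "set (supplier_order ch (Suc t)) = active_suppliers m (after t)"
    and "i \<in> active_suppliers m (after t) \<Longrightarrow>
      set (consumer_order ch (Suc t) i) = {j \<in> active_consumers n (after t). nns ch (Suc t) j = i}"
    and "j \<in> active_consumers n (after t) \<Longrightarrow> nns ch (Suc t) j \<in> active_suppliers m (after t)"
  using valid[unfolded valid_choices_def, rule_format, of "Suc t"] assms
  by (auto simp: active_suppliers_at_def active_consumers_at_def matched_consumers_at_def
      is_arg_min_def)

lemma order_subset:
  assumes "running m n (after t)"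
  shows "set (supplier_order ch (Suc t)) \<subseteq> {1..m}"
    and "i \<in> set (supplier_order ch (Suc t)) \<Longrightarrow> set (consumer_order ch (Suc t) i) \<subseteq> {1..n}"
  using valid_choices_order[OF assms] by (auto simp: active_suppliers_def active_consumers_def)

lemma valid_state_after: "valid_state m n s c D (after t)"
proof (induction t)
  case 0
  show ?case using s_pos c_pos by (auto intro!: valid_state_initial less_imp_le simp del: atLeastAtMost_iff)
next
  case (Suc t)
  then show ?case
    using valid_state_fold_serve[OF Suc order_subset] by (simp add: Let_def iteration_def)
qed

lemma weights_le_Suc: "weights_le m n (after (Suc t)) (after t)"
  using valid_state_fold_serve[OF valid_state_after order_subset]
  by (simp add: Let_def iteration_def weights_le_refl)

lemma weights_le_after: "t \<le> u \<Longrightarrow> weights_le m n (after u) (after t)"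
  by (induction rule: dec_induct) (blast intro: weights_le_refl weights_le_trans weights_le_Suc)+

text \<open>Any active consumer is served by its chosen nearest supplier, and one of the two is
  exhausted. Since active sets never grow, their total size drops strictly.\<close>

lemma active_decreases:
  assumes run: "running m n (after t)"
  shows "card (active_suppliers m (after (Suc t))) + card (active_consumers n (after (Suc t))) <
    card (active_suppliers m (after t)) + card (active_consumers n (after t))"
proof -
  obtain j where j: "j \<in> active_consumers n (after t)"
    using running_active_consumer[OF valid_state_after run balanced] .
  define i where "i = nns ch (Suc t) j"
  have i: "i \<in> active_suppliers m (after t)"
    using valid_choices_order(3)[OF run j] by (simp add: i_def)
  have "sup_weight (after (Suc t)) i \<le> 0 \<or> con_weight (after (Suc t)) j \<le> 0"
    using fold_serve_exhausts[OF valid_state_after order_subset[OF run]]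
      valid_choices_order[OF run] i j run by (simp add: i_def Let_def iteration_def)
  then have "i \<notin> active_suppliers m (after (Suc t)) \<or> j \<notin> active_consumers n (after (Suc t))"
    by (auto simp: active_suppliers_def active_consumers_def)
  then have "active_suppliers m (after (Suc t)) \<subset> active_suppliers m (after t) \<or>
      active_consumers n (after (Suc t)) \<subset> active_consumers n (after t)"
    using i j weights_le_active[OF weights_le_Suc, of t] by auto
  then show ?thesis
    using psubset_card_mono[OF finite_active(1)] psubset_card_mono[OF finite_active(2)]
      card_mono[OF finite_active(1)] card_mono[OF finite_active(2)]
      weights_le_active[OF weights_le_Suc, of t]
    by (meson add_le_less_mono add_less_le_mono)
qed

lemma terminates: "\<not> running m n (after (num_iterations m n s c D ch))"
proof -
  let ?f = "\<lambda>t. card (active_suppliers m (after t)) + card (active_consumers n (after t))"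
  have "\<exists>t. \<not> running m n (after t)"
  proof (rule ccontr)
    assume "\<not> ?thesis"
    then have "?f (Suc t) < ?f t" for t using active_decreases by blast
    then show False
      using wf_no_infinite_down_chainE[OF wf_less, of ?f] by (simp del: state_after.simps) blast
  qed
  then show ?thesis unfolding num_iterations_def by (rule LeastI_ex)
qed

text \<open>The hypothesis on \<open>jstar\<close> speaks only of suppliers with such an exhaustion
  pattern, whereas the global bound sums over all suppliers; hence every supplier has to be shown to
  have one.\<close>

lemma ex_exhausted_in_last_match:
  assumes i: "i \<in> {1..m}"
  shows "\<exists>\<Delta> \<tau>. exhausted_in_last_match m n s c D ch i \<Delta> \<tau>"
proof -
  define N where "N = num_iterations m n s c D ch"
  define w where "w t = sup_weight (after t) i" for t
  \<comment> \<open>The iteration that exhausts \<open>i\<close>; it exists because no weight is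
    positive at termination. It will turn out to be the largest element of \<open>A\<close>.\<close>
  define t0 where "t0 = (LEAST t. w t \<le> 0)"
  define A where "A = {t \<in> {1..N}. i \<in> active_suppliers_at m n s c D ch t \<and>
    1 \<le> card (matched_consumers_at m n s c D ch t i)}"
  have "w N \<le> 0"
    using terminates i by (auto simp: w_def N_def running_def not_less)
  then have t0: "w t0 \<le> 0" "t0 \<le> N"
    unfolding t0_def by (auto intro: LeastI Least_le)
  have pos: "0 < w t" if "t < t0" for t
    using that not_less_Least[of t "\<lambda>t. w t \<le> 0"] by (simp add: t0_def)
  have "w 0 = s i" by (simp add: w_def initial_state_def)
  then have "t0 \<noteq> 0" using s_pos[OF i] t0(1) by (metis not_le)
  then obtain u where u: "t0 = Suc u" by (cases t0) auto
  have act: "i \<in> active_suppliers m (after u)"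
    using pos[of u] i by (simp add: u w_def active_suppliers_def)
  then have run: "running m n (after u)"
    by (auto simp: active_suppliers_def running_def)
  \<comment> \<open>The weight falls from positive to nonpositive during iteration
    \<open>t0\<close>, which an empty list of consumers would not allow.\<close>
  have "consumer_order ch t0 i \<noteq> []"
  proof
    assume "consumer_order ch t0 i = []"
    then have "w t0 = w u"
      using run by (simp add: w_def u Let_def iteration_def sup_weight_fold_serve_unmatched)
    then show False using pos[of u] t0(1) u by simp
  qed
  then have "set (consumer_order ch (Suc u) i) \<noteq> {}" by (simp add: u)
  then have "matched_consumers_at m n s c D ch t0 i \<noteq> {}"
    unfolding valid_choices_order(2)[OF run act]
    by (simp add: u matched_consumers_at_def active_consumers_at_def)
  moreover have "finite (matched_consumers_at m n s c D ch t0 i)"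
    by (simp add: matched_consumers_at_def active_consumers_at_def finite_active)
  ultimately have "t0 \<in> A"
    using act t0(2) u
    by (simp add: A_def active_suppliers_at_def Suc_le_eq card_gt_0_iff)
  \<comment> \<open>A later iteration \<open>t\<close> starts in state \<open>t - 1\<close>, which
    is no earlier than \<open>t0\<close>, so \<open>i\<close> is no longer active there.\<close>
  have le: "t \<le> t0" if "t \<in> A" for t
  proof (rule ccontr)
    assume "\<not> t \<le> t0"
    then have "weights_le m n (after (t - 1)) (after t0)" by (intro weights_le_after) simp
    then have "w (t - 1) \<le> 0" using t0(1) i unfolding weights_le_def w_def by (blast intro: order_trans)
    then show False using that
      by (simp add: A_def active_suppliers_at_def active_suppliers_def w_def)
  qed
  have "finite A" by (simp add: A_def)
  then obtain \<tau> where \<tau>: "strict_mono_on {1..card A} \<tau>" "\<tau> ` {1..card A} = A"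
    by (rule ex_strict_mono_image_card)
  have card: "0 < card A" using \<open>finite A\<close> \<open>t0 \<in> A\<close> by (auto simp: card_gt_0_iff)
  obtain k where k: "k \<in> {1..card A}" "\<tau> k = t0" using \<tau>(2) \<open>t0 \<in> A\<close> by (metis imageE)
  \<comment> \<open>The last value of the enumeration dominates \<open>t0\<close> and lies in
    \<open>A\<close>, hence equals \<open>t0\<close>.\<close>
  have "\<tau> k \<le> \<tau> (card A)"
    using strict_mono_on_leD[OF \<tau>(1)] k(1) card by simp
  moreover have "\<tau> (card A) \<in> A" using \<tau>(2) card by (force simp: Suc_le_eq)
  ultimately have last: "\<tau> (card A) = t0" using le k(2) by force
  have "w t0 = 0"
    using t0(1) valid_state_after[of t0] i by (simp add: w_def valid_state_def order_antisym)
  then show ?thesis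
    unfolding exhausted_in_last_match_def
    using card \<tau> last pos by (auto simp: A_def N_def w_def intro!: exI[of _ "card A"] exI[of _ \<tau>])
qed

end

section \<open>Cost comparison of feasible flows\<close>

lemma feasible_flow_le:
  assumes "feasible_flow m n s c F" "i \<in> {1..m}" "j \<in> {1..n}"
  shows "F i j \<le> c j"
proof -
  have "F i j \<le> (\<Sum>i=1..m. F i j)"
    using assms by (intro member_le_sum) (auto simp: feasible_flow_def)
  then show ?thesis using assms by (simp add: feasible_flow_def)
qed

text \<open>Outside the receivers \<open>G\<close> costs nothing and \<open>F\<close> costs at least
  0, so only receivers matter. Stating it for two arbitrary feasible flows covers both
  \<open>F\<close> and \<open>Fopt\<close>.\<close>

lemma supplier_cost_diff_le:
  assumes G: "feasible_flow m n s c G" and F: "feasible_flow m n s c F" and i: "i \<in> {1..m}"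
    and D: "\<And>j. j \<in> {1..n} \<Longrightarrow> 0 \<le> D i j"
    and k: "is_furthest_receiver n D G i k"
  shows "(\<Sum>j=1..n. G i j * D i j) - (\<Sum>j=1..n. F i j * D i j) \<le>
    D i k * (\<Sum>j\<in>receivers n G i. c j - F i j)"
proof -
  let ?J = "receivers n G i"
  have J: "?J \<subseteq> {1..n}" "finite ?J" by (auto simp: receivers_def)
  have Gnn: "0 \<le> G i j" and Fnn: "0 \<le> F i j" if "j \<in> {1..n}" for j
    using G F i that by (auto simp: feasible_flow_def)
  have "(\<Sum>j=1..n. G i j * D i j) = (\<Sum>j\<in>?J. G i j * D i j)"
    using J Gnn by (intro sum.mono_neutral_right) (auto simp: receivers_def less_le)
  moreover have "(\<Sum>j\<in>?J. F i j * D i j) \<le> (\<Sum>j=1..n. F i j * D i j)"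
    using J Fnn D by (intro sum_mono2) auto
  ultimately have "(\<Sum>j=1..n. G i j * D i j) - (\<Sum>j=1..n. F i j * D i j) \<le>
      (\<Sum>j\<in>?J. (G i j - F i j) * D i j)"
    by (simp add: left_diff_distrib sum_subtractf)
  also have "\<dots> \<le> (\<Sum>j\<in>?J. D i k * (c j - F i j))"
  proof (rule sum_mono)
    fix j assume "j \<in> ?J"
    then have j: "j \<in> {1..n}" and "D i j \<le> D i k"
      using J k by (auto simp: is_furthest_receiver_def)
    \<comment> \<open>Enlarging the distance needs a nonnegative factor. The difference
      \<open>G i j - F i j\<close> may be negative, but \<open>c j - F i j\<close> is not, so
      \<open>G i j\<close> is replaced by \<open>c j\<close> before the distance is
      enlarged.\<close>
    then have "(c j - F i j) * D i j \<le> (c j - F i j) * D i k"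
      using feasible_flow_le[OF F i] by (intro mult_left_mono) auto
    moreover have "(G i j - F i j) * D i j \<le> (c j - F i j) * D i j"
      using feasible_flow_le[OF G i j] D[OF j] by (intro mult_right_mono) auto
    ultimately show "(G i j - F i j) * D i j \<le> D i k * (c j - F i j)"
      by (simp add: mult.commute)
  qed
  finally show ?thesis by (simp add: sum_distrib_left)
qed

text \<open>An optimal flow attains the minimum, which gives the \<open>LEAST\<close> over the reals
  its meaning.\<close>

lemma EMD_optimal_flow:
  assumes "optimal_flow m n s c D F"
  shows "EMD m n s c D = flow_cost m n D F"
  unfolding EMD_def by (rule Least_equality) (use assms in \<open>auto simp: optimal_flow_def\<close>)

theorem theorem1:
  fixes X :: "'a set" and d :: "'a \<Rightarrow> 'a \<Rightarrow> real"
    and m n :: nat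
    and x y :: "nat \<Rightarrow> 'a"
    and s c :: "nat \<Rightarrow> real"
    and D Fstar F Fopt :: "nat \<Rightarrow> nat \<Rightarrow> real"
    and R :: real
    and ch :: choices
    and jstar :: "nat \<Rightarrow> nat"
  assumes "Metric_space X d" and "finite X"
    and "histogram X m x s" and "histogram X n y c"
    and "\<And>i j. i \<in> {1..m} \<Longrightarrow> j \<in> {1..n} \<Longrightarrow> D i j = d (x i) (y j)"
    and "valid_choices m n s c D ch"
    and "(R, Fstar) = nns_emd_output m n s c D ch"
    and "feasible_flow m n s c F"
    and "optimal_flow m n s c D Fopt"
    and "\<And>i \<Delta> \<tau>. i \<in> {1..m} \<Longrightarrow> exhausted_in_last_match m n s c D ch i \<Delta> \<tau> \<Longrightarrow>
           is_furthest_receiver n D Fstar i (jstar i)"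
  shows "(\<forall>i\<in>{1..m}. \<forall>\<Delta> \<tau>. exhausted_in_last_match m n s c D ch i \<Delta> \<tau> \<longrightarrow>
            (\<Sum>j=1..n. Fstar i j * D i j) - (\<Sum>j=1..n. F i j * D i j)
              \<le> D i (jstar i) * (\<Sum>j\<in>receivers n Fstar i. c j - F i j)) \<and>
         R = (\<Sum>i=1..m. \<Sum>j=1..n. Fstar i j * D i j) \<and>
         EMD m n s c D = (\<Sum>i=1..m. \<Sum>j=1..n. Fopt i j * D i j) \<and>
         0 \<le> (\<Sum>i=1..m. \<Sum>j=1..n. Fstar i j * D i j) - (\<Sum>i=1..m. \<Sum>j=1..n. Fopt i j * D i j) \<and>
         (\<Sum>i=1..m. \<Sum>j=1..n. Fstar i j * D i j) - (\<Sum>i=1..m. \<Sum>j=1..n. Fopt i j * D i j)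
           \<le> (\<Sum>i=1..m. D i (jstar i) * (\<Sum>j\<in>receivers n Fstar i. c j - Fopt i j))"
proof -
  have s: "\<And>i. i \<in> {1..m} \<Longrightarrow> 0 < s i" and c: "\<And>j. j \<in> {1..n} \<Longrightarrow> 0 < c j"
    and bal: "(\<Sum>i=1..m. s i) = (\<Sum>j=1..n. c j)"
    using assms(3,4) by (auto simp: histogram_def)
  have D: "0 \<le> D i j" if "i \<in> {1..m}" "j \<in> {1..n}" for i j
    using assms(5)[OF that] Metric_space.nonneg[OF assms(1)] by simp
  define st where "st = state_after m n s c D ch (num_iterations m n s c D ch)"
  have st: "valid_state m n s c D st" "\<not> running m n st"
    unfolding st_def
    using valid_state_after[OF s c bal assms(6)] terminates[OF s c bal assms(6)] by blast+
  have out: "R = total_cost st" "Fstar = flow st"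
    using assms(7) by (simp_all add: nns_emd_output_def st_def Let_def)
  have Fstar: "feasible_flow m n s c Fstar"
    using not_running_valid_state[OF st] by (simp add: out)
  have Fopt: "feasible_flow m n s c Fopt" "flow_cost m n D Fopt \<le> flow_cost m n D Fstar"
    using assms(9) Fstar by (auto simp: optimal_flow_def)
  have furthest: "is_furthest_receiver n D Fstar i (jstar i)" if "i \<in> {1..m}" for i
    using ex_exhausted_in_last_match[OF s c bal assms(6) that] assms(10)[OF that] by auto
  have "R = flow_cost m n D Fstar"
    using st(1) by (simp add: out valid_state_def)
  moreover have "flow_cost m n D Fstar - flow_cost m n D Fopt \<le>
      (\<Sum>i=1..m. D i (jstar i) * (\<Sum>j\<in>receivers n Fstar i. c j - Fopt i j))"
    \<comment> \<open>Only the outer sums are merged, leaving for each supplier the cost difference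
      that \<open>supplier_cost_diff_le\<close> bounds.\<close>
    unfolding flow_cost_def sum_subtractf[of _ _ "{1..m}", symmetric]
    by (intro sum_mono supplier_cost_diff_le[OF Fstar Fopt(1) _ D furthest])
  moreover have "(\<Sum>j=1..n. Fstar i j * D i j) - (\<Sum>j=1..n. F i j * D i j)
      \<le> D i (jstar i) * (\<Sum>j\<in>receivers n Fstar i. c j - F i j)" if "i \<in> {1..m}" for i
    using supplier_cost_diff_le[OF Fstar assms(8) that D furthest] that by blast
  ultimately show ?thesis
    using Fopt(2) EMD_optimal_flow[OF assms(9)] unfolding flow_cost_def by auto
qed

end
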